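(* Let $(A,\mu,\Delta,\alpha,R)$ be a cobraided Hom-bialgebra over $\mathbf{k}$ with $\alpha$ injective. Then $$A^{(n)}=(A,\mu,\Delta,\alpha,R^{\alpha^n})$$ is also a cobraided Hom-bialgebra for each $n\ge 1$, where $R^{\alpha^n}=R\circ(\alpha^n\otimes\alpha^n)$.
   Context: $\mathbf{k}$ is a fixed associative and commutative ring of characteristic $0$; modules, tensor products and linear maps are over $\mathbf{k}$. Write $\Delta(x)=\sum x_1\otimes x_2$ (Sweedler) and $xy=\mu(x,y)$. A Hom-bialgebra $(A,\mu,\Delta,\alpha)$ consists of a $\mathbf{k}$-module $A$, a bilinear map $\mu\colon A^{\otimes 2}\to A$, a linear map $\Delta\colon A\to A^{\otimes 2}$ and a linear map $\alpha\colon A\to A$ such that $\alpha\circ\mu=\mu\circ\alpha^{\otimes 2}$, $\mu\circ(\alpha\otimes\mu)=\mu\circ(\mu\otimes\alpha)$, $\alpha^{\otimes 2}\circ\Delta=\Delta\circ\alpha$, $(\alpha\otimes\Delta)\circ\Delta=(\Delta\otimes\alpha)\circ\Delta$, and $\Delta(ab)=\sum a_1b_1\otimes a_2b_2$ for all $a,b\in A$. No unit or counit is required. A cobraided Hom-bialgebra $(A,\mu,\Delta,\alpha,R)$ is a Hom-bialgebra $(A,\mu,\Delta,\alpha)$ with a bilinear form $R\in\mathrm{Hom}(A^{\otimes 2},\mathbf{k})$ such that for all $x,y,z\in A$: (1) $R(xy\otimes\alpha(z))=\sum R(\alpha(x)\otimes z_1)R(\alpha(y)\otimes z_2)$; (2)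 $R(\alpha(x)\otimes yz)=\sum R(x_1\otimes\alpha(z))R(x_2\otimes\alpha(y))$; (3) $\sum y_1x_1R(x_2\otimes y_2)=\sum R(x_1\otimes y_1)x_2y_2$. *)

theory Defs
  imports "HOL-Algebra.Module" "HOL-Algebra.Free_Abelian_Groups"
begin

definition linear_maps ::
  "('k, 'm) ring_scheme \<Rightarrow> ('k, 'a, 'p) module_scheme \<Rightarrow> ('k, 'b, 'q) module_scheme \<Rightarrow> ('a \<Rightarrow> 'b) set"
  where
  "linear_maps K M N =
     {f \<in> carrier M \<rightarrow> carrier N.
        (\<forall>x\<in>carrier M. \<forall>y\<in>carrier M. f (x \<oplus>\<^bsub>M\<^esub> y) = f x \<oplus>\<^bsub>N\<^esub> f y) \<and>
        (\<forall>c\<in>carrier K. \<forall>x\<in>carrier M. f (c \<odot>\<^bsub>M\<^esub> x) = c \<odot>\<^bsub>N\<^esub> f x)}"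

definition regular_module :: "('k, 'm) ring_scheme \<Rightarrow> ('k, 'k) module"
  where
  "regular_module K =
     \<lparr>carrier = carrier K, monoid.mult = monoid.mult K, monoid.one = monoid.one K, ring.zero = ring.zero K, ring.add = ring.add K,
      smult = monoid.mult K\<rparr>"

text \<open>The tensor product of two modules over a commutative ring is the free abelian group on
  pairs, modulo additivity in each variable and balancedness. The scalar \<open>c\<close> acts by
  \<open>(x, y) \<mapsto> (c x, y)\<close>.\<close>

definition tensor_relations ::
  "('k, 'm) ring_scheme \<Rightarrow> ('k, 'a, 'p) module_scheme \<Rightarrow> ('k, 'b, 'q) module_scheme
     \<Rightarrow> ('a \<times> 'b \<Rightarrow>\<^sub>0 int) set"
  where
  "tensor_relations K M N =
     {frag_of (x \<oplus>\<^bsub>M\<^esub> x', y) - frag_of (x, y) - frag_of (x', y) | x x' y.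
        x \<in> carrier M \<and> x' \<in> carrier M \<and> y \<in> carrier N} \<union>
     {frag_of (x, y \<oplus>\<^bsub>N\<^esub> y') - frag_of (x, y) - frag_of (x, y') | x y y'.
        x \<in> carrier M \<and> y \<in> carrier N \<and> y' \<in> carrier N} \<union>
     {frag_of (c \<odot>\<^bsub>M\<^esub> x, y) - frag_of (x, c \<odot>\<^bsub>N\<^esub> y) | c x y.
        c \<in> carrier K \<and> x \<in> carrier M \<and> y \<in> carrier N}"

abbreviation tensor_free ::
  "('k, 'a, 'p) module_scheme \<Rightarrow> ('k, 'b, 'q) module_scheme \<Rightarrow> ('a \<times> 'b \<Rightarrow>\<^sub>0 int) monoid"
  where
  "tensor_free M N \<equiv> free_Abelian_group (carrier M \<times> carrier N)"

definition tensor_kernel ::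
  "('k, 'm) ring_scheme \<Rightarrow> ('k, 'a, 'p) module_scheme \<Rightarrow> ('k, 'b, 'q) module_scheme
     \<Rightarrow> ('a \<times> 'b \<Rightarrow>\<^sub>0 int) set"
  where
  "tensor_kernel K M N = generate (tensor_free M N) (tensor_relations K M N)"

text \<open>The multiplicative fields of the record are irrelevant for a module.\<close>

definition tensor ::
  "('k, 'm) ring_scheme \<Rightarrow> ('k, 'a, 'p) module_scheme \<Rightarrow> ('k, 'b, 'q) module_scheme
     \<Rightarrow> ('k, ('a \<times> 'b \<Rightarrow>\<^sub>0 int) set) module"
  where
  "tensor K M N =
     \<lparr>carrier = carrier (tensor_free M N Mod tensor_kernel K M N),
      monoid.mult = undefined, monoid.one = undefined,
      ring.zero = monoid.one (tensor_free M N Mod tensor_kernel K M N),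
      ring.add = monoid.mult (tensor_free M N Mod tensor_kernel K M N),
      smult = (\<lambda>c t. \<Union>u\<in>t. tensor_kernel K M N #>\<^bsub>tensor_free M N\<^esub>
                 frag_extend (\<lambda>(x, y). frag_of (c \<odot>\<^bsub>M\<^esub> x, y)) u)\<rparr>"

definition pure_tensor ::
  "('k, 'm) ring_scheme \<Rightarrow> ('k, 'a, 'p) module_scheme \<Rightarrow> ('k, 'b, 'q) module_scheme
     \<Rightarrow> 'a \<Rightarrow> 'b \<Rightarrow> ('a \<times> 'b \<Rightarrow>\<^sub>0 int) set"
  where
  "pure_tensor K M N x y = tensor_kernel K M N #>\<^bsub>tensor_free M N\<^esub> frag_of (x, y)"

text \<open>The linear map \<open>M \<otimes> N \<rightarrow> P\<close> induced by a bilinear map \<open>B\<close>. Existence, and uniqueness on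
  the carrier, are proved below.\<close>

definition tensor_lift ::
  "('k, 'm) ring_scheme \<Rightarrow> ('k, 'a, 'p) module_scheme \<Rightarrow> ('k, 'b, 'q) module_scheme
     \<Rightarrow> ('k, 'c, 'r) module_scheme \<Rightarrow> ('a \<Rightarrow> 'b \<Rightarrow> 'c) \<Rightarrow> ('a \<times> 'b \<Rightarrow>\<^sub>0 int) set \<Rightarrow> 'c"
  where
  "tensor_lift K M N P B =
     (SOME f. f \<in> linear_maps K (tensor K M N) P \<and>
        (\<forall>x\<in>carrier M. \<forall>y\<in>carrier N. f (pure_tensor K M N x y) = B x y))"

definition tensor_map ::
  "('k, 'm) ring_scheme \<Rightarrow> ('k, 'a, 'p) module_scheme \<Rightarrow> ('k, 'b, 'q) module_scheme
     \<Rightarrow> ('k, 'c, 'r) module_scheme \<Rightarrow> ('k, 'd, 's) module_scheme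
     \<Rightarrow> ('a \<Rightarrow> 'c) \<Rightarrow> ('b \<Rightarrow> 'd) \<Rightarrow> ('a \<times> 'b \<Rightarrow>\<^sub>0 int) set \<Rightarrow> ('c \<times> 'd \<Rightarrow>\<^sub>0 int) set"
  where
  "tensor_map K M N M' N' f g =
     tensor_lift K M N (tensor K M' N') (\<lambda>x y. pure_tensor K M' N' (f x) (g y))"

text \<open>The associator \<open>(M \<otimes> N) \<otimes> P \<rightarrow> M \<otimes> (N \<otimes> P)\<close>.\<close>

definition tensor_assoc ::
  "('k, 'm) ring_scheme \<Rightarrow> ('k, 'a, 'p) module_scheme \<Rightarrow> ('k, 'b, 'q) module_scheme
     \<Rightarrow> ('k, 'c, 'r) module_scheme \<Rightarrow> (('a \<times> 'b \<Rightarrow>\<^sub>0 int) set \<times> 'c \<Rightarrow>\<^sub>0 int) set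
     \<Rightarrow> ('a \<times> ('b \<times> 'c \<Rightarrow>\<^sub>0 int) set \<Rightarrow>\<^sub>0 int) set"
  where
  "tensor_assoc K M N P =
     tensor_lift K (tensor K M N) P (tensor K M (tensor K N P))
       (\<lambda>t z. tensor_lift K M N (tensor K M (tensor K N P))
          (\<lambda>x y. pure_tensor K M (tensor K N P) x (pure_tensor K N P y z)) t)"


section \<open>Basic properties of the tensor product\<close>

locale tensor_pair = M: module K M + N: module K N
  for K :: "('k, 'm) ring_scheme" (structure) and M :: "('k, 'a, 'p) module_scheme"
    and N :: "('k, 'b, 'q) module_scheme"
begin

abbreviation "F \<equiv> tensor_free M N"
abbreviation "H \<equiv> tensor_kernel K M N"
abbreviation "T \<equiv> tensor K M N"
abbreviation "scl c \<equiv> frag_extend (\<lambda>(x, y). frag_of (c \<odot>\<^bsub>M\<^esub> x, y) :: 'a \<times> 'b \<Rightarrow>\<^sub>0 int)"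

sublocale F: comm_group F
  by (rule abelian_free_Abelian_group)

lemma frag_carrier: "x \<in> carrier M \<Longrightarrow> y \<in> carrier N \<Longrightarrow> frag_of (x, y) \<in> carrier F"
  by simp

lemma diff_carrier: "u \<in> carrier F \<Longrightarrow> v \<in> carrier F \<Longrightarrow> u - v \<in> carrier F"
  using keys_diff[of u v] by auto

lemma relations_carrier: "tensor_relations K M N \<subseteq> carrier F"
  unfolding tensor_relations_def
  by (auto simp del: carrier_free_Abelian_group_iff
      intro!: diff_carrier frag_carrier)

lemma subgroup_H: "subgroup H F"
  unfolding tensor_kernel_def by (rule F.generate_is_subgroup[OF relations_carrier])

sublocale H: normal H F
  by (rule F.subgroup_imp_normal[OF subgroup_H])

lemma relation_in_H: "u \<in> tensor_relations K M N \<Longrightarrow> u \<in> H"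
  unfolding tensor_kernel_def by (rule generate.incl)

lemma add_left_in_H:
  assumes "x \<in> carrier M" "x' \<in> carrier M" "y \<in> carrier N"
  shows "frag_of (x \<oplus>\<^bsub>M\<^esub> x', y) - (frag_of (x, y) + frag_of (x', y)) \<in> H"
  unfolding diff_diff_eq[symmetric] using assms
  by (intro relation_in_H) (unfold tensor_relations_def, blast)

lemma add_right_in_H:
  assumes "x \<in> carrier M" "y \<in> carrier N" "y' \<in> carrier N"
  shows "frag_of (x, y \<oplus>\<^bsub>N\<^esub> y') - (frag_of (x, y) + frag_of (x, y')) \<in> H"
  unfolding diff_diff_eq[symmetric] using assms
  by (intro relation_in_H) (unfold tensor_relations_def, blast)

lemma coset_eq_iff:
  assumes "u \<in> carrier F" "v \<in> carrier F"
  shows "H #>\<^bsub>F\<^esub> u = H #>\<^bsub>F\<^esub> v \<longleftrightarrow> u - v \<in> H"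
proof
  assume "H #>\<^bsub>F\<^esub> u = H #>\<^bsub>F\<^esub> v"
  then have "u \<in> H #>\<^bsub>F\<^esub> v"
    using F.rcos_self[OF assms(1) subgroup_H] by simp
  then show "u - v \<in> H"
    by (auto simp: r_coset_def)
next
  assume "u - v \<in> H"
  then have "u \<in> H #>\<^bsub>F\<^esub> v"
    by (auto simp: r_coset_def intro!: bexI[of _ "u - v"])
  then show "H #>\<^bsub>F\<^esub> u = H #>\<^bsub>F\<^esub> v"
    using F.repr_independence[OF _ assms(2) subgroup_H] by simp
qed

lemma scl_carrier:
  assumes "c \<in> carrier K" "u \<in> carrier F"
  shows "scl c u \<in> carrier F"
proof -
  have "Poly_Mapping.keys (scl c u) \<subseteq>
      (\<Union>p\<in>Poly_Mapping.keys u. Poly_Mapping.keys ((\<lambda>(x, y). frag_of (c \<odot>\<^bsub>M\<^esub> x, y) :: 'a \<times> 'b \<Rightarrow>\<^sub>0 int) p))"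
    by (rule keys_frag_extend)
  also have "\<dots> \<subseteq> carrier M \<times> carrier N"
    using assms by (auto split: prod.splits)
  finally show ?thesis by simp
qed

lemma scl_relation:
  assumes "c \<in> carrier K" "u \<in> tensor_relations K M N"
  shows "scl c u \<in> tensor_relations K M N"
proof -
  consider (1) x x' y where "u = frag_of (x \<oplus>\<^bsub>M\<^esub> x', y) - frag_of (x, y) - frag_of (x', y)"
        "x \<in> carrier M" "x' \<in> carrier M" "y \<in> carrier N"
    | (2) x y y' where "u = frag_of (x, y \<oplus>\<^bsub>N\<^esub> y') - frag_of (x, y) - frag_of (x, y')"
        "x \<in> carrier M" "y \<in> carrier N" "y' \<in> carrier N"
    | (3) d x y where "u = frag_of (d \<odot>\<^bsub>M\<^esub> x, y) - frag_of (x, d \<odot>\<^bsub>N\<^esub> y)"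
        "d \<in> carrier K" "x \<in> carrier M" "y \<in> carrier N"
    using assms(2) unfolding tensor_relations_def by blast
  then show ?thesis
  proof cases
    case 1
    have "scl c u = frag_of (c \<odot>\<^bsub>M\<^esub> x \<oplus>\<^bsub>M\<^esub> c \<odot>\<^bsub>M\<^esub> x', y) - frag_of (c \<odot>\<^bsub>M\<^esub> x, y) - frag_of (c \<odot>\<^bsub>M\<^esub> x', y)"
      using 1 assms by (simp add: frag_extend_diff M.smult_r_distr)
    then show ?thesis
      using 1 assms unfolding tensor_relations_def by blast
  next
    case 2
    have "scl c u = frag_of (c \<odot>\<^bsub>M\<^esub> x, y \<oplus>\<^bsub>N\<^esub> y') - frag_of (c \<odot>\<^bsub>M\<^esub> x, y) - frag_of (c \<odot>\<^bsub>M\<^esub> x, y')"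
      using 2 assms by (simp add: frag_extend_diff)
    then show ?thesis
      using 2 assms unfolding tensor_relations_def by blast
  next
    case 3
    have "c \<odot>\<^bsub>M\<^esub> (d \<odot>\<^bsub>M\<^esub> x) = d \<odot>\<^bsub>M\<^esub> (c \<odot>\<^bsub>M\<^esub> x)"
      using 3 assms by (simp add: M.smult_assoc1[symmetric] M.R.m_comm)
    then have "scl c u = frag_of (d \<odot>\<^bsub>M\<^esub> (c \<odot>\<^bsub>M\<^esub> x), y) - frag_of (c \<odot>\<^bsub>M\<^esub> x, d \<odot>\<^bsub>N\<^esub> y)"
      using 3 by (simp add: frag_extend_diff)
    then show ?thesis
      using 3 assms unfolding tensor_relations_def by blast
  qed
qed

lemma scl_H:
  assumes "c \<in> carrier K" "u \<in> H"
  shows "scl c u \<in> H"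
  using assms(2) unfolding tensor_kernel_def
proof (induction u rule: generate.induct)
  case one
  show ?case using generate.one[of F] by simp
next
  case (incl h)
  then show ?case by (intro generate.incl scl_relation assms)
next
  case (inv h)
  have c: "h \<in> carrier F" using inv relations_carrier by blast
  have "scl c h \<in> tensor_relations K M N" by (intro scl_relation assms inv)
  then have "inv\<^bsub>F\<^esub> (scl c h) \<in> generate F (tensor_relations K M N)"
    by (rule generate.inv)
  then show ?case using c scl_carrier[OF assms(1) c] by (simp add: frag_extend_minus)
next
  case (eng h1 h2)
  then show ?case using generate.eng[of _ F] by (simp add: frag_extend_add)
qed

lemma tensor_carrier: "carrier T = (\<lambda>u. H #>\<^bsub>F\<^esub> u) ` carrier F"
  by (simp add: tensor_def carrier_FactGroup)

lemma coset_closed [simp]: "u \<in> carrier F \<Longrightarrow> H #>\<^bsub>F\<^esub> u \<in> carrier T"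
  unfolding tensor_carrier by (rule imageI)

lemma tensor_zero: "\<zero>\<^bsub>T\<^esub> = H #>\<^bsub>F\<^esub> 0"
  using F.coset_mult_one[OF H.subset] by (simp add: tensor_def)

lemma tensor_add:
  "u \<in> carrier F \<Longrightarrow> v \<in> carrier F \<Longrightarrow>
   (H #>\<^bsub>F\<^esub> u) \<oplus>\<^bsub>T\<^esub> (H #>\<^bsub>F\<^esub> v) = H #>\<^bsub>F\<^esub> (u + v)"
  using H.rcos_sum[of u v] by (simp add: tensor_def)

lemma tensor_smult:
  assumes "c \<in> carrier K" "u \<in> carrier F"
  shows "c \<odot>\<^bsub>T\<^esub> (H #>\<^bsub>F\<^esub> u) = H #>\<^bsub>F\<^esub> scl c u"
proof -
  have *: "H #>\<^bsub>F\<^esub> scl c v = H #>\<^bsub>F\<^esub> scl c u" if v: "v \<in> H #>\<^bsub>F\<^esub> u" for v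
  proof -
    have vF: "v \<in> carrier F"
      using v F.r_coset_subset_G[OF H.subset assms(2)] by blast
    have "H #>\<^bsub>F\<^esub> v = H #>\<^bsub>F\<^esub> u"
      using F.repr_independence[OF v assms(2) subgroup_H] by simp
    then have "scl c (v - u) \<in> H"
      using scl_H assms coset_eq_iff[OF vF assms(2)] by blast
    then show ?thesis
      using coset_eq_iff[OF scl_carrier[OF assms(1) vF] scl_carrier[OF assms]]
      by (simp add: frag_extend_diff)
  qed
  have "u \<in> H #>\<^bsub>F\<^esub> u" using F.rcos_self[OF assms(2) subgroup_H] .
  then have "(\<Union>v\<in>H #>\<^bsub>F\<^esub> u. H #>\<^bsub>F\<^esub> scl c v) = H #>\<^bsub>F\<^esub> scl c u"
    using * by (intro SUP_eq_const) blast+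
  then show ?thesis
    unfolding tensor_def by simp
qed

lemma add_carrier: "u \<in> carrier F \<Longrightarrow> v \<in> carrier F \<Longrightarrow> u + v \<in> carrier F"
  using F.m_closed[of u v] by (simp only: mult_free_Abelian_group)

lemma diff_in_HI:
  assumes u: "u \<in> carrier F"
    and f: "\<And>x y. x \<in> carrier M \<Longrightarrow> y \<in> carrier N \<Longrightarrow> f (frag_of (x, y)) - g (frag_of (x, y)) \<in> H"
    and f0: "f 0 = 0" "g 0 = 0"
    and fd: "\<And>u v. f (u - v) = f u - f v" and gd: "\<And>u v. g (u - v) = g u - g v"
  shows "f u - g u \<in> H"
proof -
  have "Poly_Mapping.keys u \<subseteq> carrier M \<times> carrier N" using u by simp
  then show ?thesis
  proof (induction rule: free_Abelian_group_induct[consumes 1])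
    case 1
    show ?case using f0 H.one_closed by simp
  next
    case (2 u v)
    have "(f u - g u) \<otimes>\<^bsub>F\<^esub> inv\<^bsub>F\<^esub> (f v - g v) \<in> H"
      using 2 by (intro H.m_closed H.m_inv_closed)
    moreover have "f v - g v \<in> carrier F" using 2 H.subset by blast
    ultimately show ?case by (simp add: fd gd algebra_simps)
  next
    case (3 p)
    then show ?case using f by (cases p) auto
  qed
qed

lemma tensor_module: "module K T"
proof (rule moduleI)
  show "cring K" by (rule M.R.is_cring)
  show "abelian_group T"
  proof (rule abelian_groupI)
    fix s t w assume "s \<in> carrier T" "t \<in> carrier T" "w \<in> carrier T"
    then obtain a b c where "a \<in> carrier F" "b \<in> carrier F" "c \<in> carrier F"
      "s = H #>\<^bsub>F\<^esub> a" "t = H #>\<^bsub>F\<^esub> b" "w = H #>\<^bsub>F\<^esub> c"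
      unfolding tensor_carrier by blast
    then show "s \<oplus>\<^bsub>T\<^esub> t \<oplus>\<^bsub>T\<^esub> w = s \<oplus>\<^bsub>T\<^esub> (t \<oplus>\<^bsub>T\<^esub> w)"
      by (simp add: tensor_add add_carrier add.assoc del: carrier_free_Abelian_group_iff)
  next
    fix s t assume "s \<in> carrier T" "t \<in> carrier T"
    then obtain a b where ab: "a \<in> carrier F" "b \<in> carrier F" "s = H #>\<^bsub>F\<^esub> a" "t = H #>\<^bsub>F\<^esub> b"
      unfolding tensor_carrier by blast
    then show "s \<oplus>\<^bsub>T\<^esub> t \<in> carrier T" "s \<oplus>\<^bsub>T\<^esub> t = t \<oplus>\<^bsub>T\<^esub> s"
      by (simp_all add: tensor_add add_carrier add.commute del: carrier_free_Abelian_group_iff)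
  next
    show "\<zero>\<^bsub>T\<^esub> \<in> carrier T" by (simp add: tensor_zero)
  next
    fix s assume "s \<in> carrier T"
    then obtain a where a: "a \<in> carrier F" "s = H #>\<^bsub>F\<^esub> a"
      unfolding tensor_carrier by blast
    have [simp]: "0 \<in> carrier F" by simp
    show "\<zero>\<^bsub>T\<^esub> \<oplus>\<^bsub>T\<^esub> s = s"
      using a by (simp add: tensor_zero tensor_add del: carrier_free_Abelian_group_iff)
    have "- a \<in> carrier F" using a by simp
    then show "\<exists>t\<in>carrier T. t \<oplus>\<^bsub>T\<^esub> s = \<zero>\<^bsub>T\<^esub>"
      using a by (intro bexI[of _ "H #>\<^bsub>F\<^esub> (- a)"])
        (simp_all add: tensor_zero tensor_add del: carrier_free_Abelian_group_iff)
  qed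
next
  fix c s assume "c \<in> carrier K" "s \<in> carrier T"
  then show "c \<odot>\<^bsub>T\<^esub> s \<in> carrier T"
    using scl_carrier unfolding tensor_carrier by (auto simp: tensor_smult simp del: carrier_free_Abelian_group_iff)
next
  fix c d s assume cd: "c \<in> carrier K" "d \<in> carrier K" and "s \<in> carrier T"
  then obtain a where a: "a \<in> carrier F" "s = H #>\<^bsub>F\<^esub> a"
    unfolding tensor_carrier by blast
  have "scl (c \<oplus> d) a - (scl c a + scl d a) \<in> H"
  proof (rule diff_in_HI[OF a(1)])
    fix x y assume "x \<in> carrier M" "y \<in> carrier N"
    then show "scl (c \<oplus> d) (frag_of (x, y)) - (scl c (frag_of (x, y)) + scl d (frag_of (x, y))) \<in> H"
      using cd add_left_in_H[of "c \<odot>\<^bsub>M\<^esub> x" "d \<odot>\<^bsub>M\<^esub> x" y] by (simp add: M.smult_l_distr)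
  qed (auto simp: frag_extend_diff)
  then show "(c \<oplus> d) \<odot>\<^bsub>T\<^esub> s = c \<odot>\<^bsub>T\<^esub> s \<oplus>\<^bsub>T\<^esub> d \<odot>\<^bsub>T\<^esub> s"
    using a cd by (simp add: tensor_smult tensor_add scl_carrier add_carrier coset_eq_iff
        del: carrier_free_Abelian_group_iff)
next
  fix c s t assume c: "c \<in> carrier K" and "s \<in> carrier T" "t \<in> carrier T"
  then obtain a b where ab: "a \<in> carrier F" "b \<in> carrier F" "s = H #>\<^bsub>F\<^esub> a" "t = H #>\<^bsub>F\<^esub> b"
    unfolding tensor_carrier by blast
  then show "c \<odot>\<^bsub>T\<^esub> (s \<oplus>\<^bsub>T\<^esub> t) = c \<odot>\<^bsub>T\<^esub> s \<oplus>\<^bsub>T\<^esub> c \<odot>\<^bsub>T\<^esub> t"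
    using c by (simp add: tensor_smult tensor_add scl_carrier add_carrier frag_extend_add
        del: carrier_free_Abelian_group_iff)
next
  fix c d s assume cd: "c \<in> carrier K" "d \<in> carrier K" and "s \<in> carrier T"
  then obtain a where a: "a \<in> carrier F" "s = H #>\<^bsub>F\<^esub> a"
    unfolding tensor_carrier by blast
  have "scl (c \<otimes> d) a - scl c (scl d a) \<in> H"
  proof (rule diff_in_HI[OF a(1)])
    fix x y assume "x \<in> carrier M" "y \<in> carrier N"
    then show "scl (c \<otimes> d) (frag_of (x, y)) - scl c (scl d (frag_of (x, y))) \<in> H"
      using cd H.one_closed by (simp add: M.smult_assoc1)
  qed (auto simp: frag_extend_diff)
  then show "(c \<otimes> d) \<odot>\<^bsub>T\<^esub> s = c \<odot>\<^bsub>T\<^esub> (d \<odot>\<^bsub>T\<^esub> s)"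
    using a cd by (simp add: tensor_smult scl_carrier coset_eq_iff
        del: carrier_free_Abelian_group_iff)
next
  fix s assume "s \<in> carrier T"
  then obtain a where a: "a \<in> carrier F" "s = H #>\<^bsub>F\<^esub> a"
    unfolding tensor_carrier by blast
  have "scl \<one> a - a \<in> H"
  proof (rule diff_in_HI[OF a(1), where g = "\<lambda>u. u"])
    fix x y assume "x \<in> carrier M" "y \<in> carrier N"
    then show "scl \<one> (frag_of (x, y)) - frag_of (x, y) \<in> H"
      using H.one_closed by simp
  qed (auto simp: frag_extend_diff)
  then show "\<one> \<odot>\<^bsub>T\<^esub> s = s"
    using a by (simp add: tensor_smult scl_carrier coset_eq_iff
        del: carrier_free_Abelian_group_iff)
qed

lemma pure_closed:
  "x \<in> carrier M \<Longrightarrow> y \<in> carrier N \<Longrightarrow> pure_tensor K M N x y \<in> carrier T"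
  unfolding pure_tensor_def by (simp add: frag_carrier)

lemma pure_add_left:
  assumes "x \<in> carrier M" "x' \<in> carrier M" "y \<in> carrier N"
  shows "pure_tensor K M N (x \<oplus>\<^bsub>M\<^esub> x') y = pure_tensor K M N x y \<oplus>\<^bsub>T\<^esub> pure_tensor K M N x' y"
proof -
  have "frag_of (x \<oplus>\<^bsub>M\<^esub> x', y) - (frag_of (x, y) + frag_of (x', y)) \<in> H"
    using assms by (rule add_left_in_H)
  then show ?thesis
    using assms unfolding pure_tensor_def
    by (simp add: tensor_add coset_eq_iff frag_carrier add_carrier del: carrier_free_Abelian_group_iff frag_of_in_free_Abelian_group)
qed

lemma pure_add_right:
  assumes "x \<in> carrier M" "y \<in> carrier N" "y' \<in> carrier N"
  shows "pure_tensor K M N x (y \<oplus>\<^bsub>N\<^esub> y') = pure_tensor K M N x y \<oplus>\<^bsub>T\<^esub> pure_tensor K M N x y'"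
proof -
  have "frag_of (x, y \<oplus>\<^bsub>N\<^esub> y') - (frag_of (x, y) + frag_of (x, y')) \<in> H"
    using assms by (rule add_right_in_H)
  then show ?thesis
    using assms unfolding pure_tensor_def
    by (simp add: tensor_add coset_eq_iff frag_carrier add_carrier del: carrier_free_Abelian_group_iff frag_of_in_free_Abelian_group)
qed

lemma pure_smult_left:
  assumes "c \<in> carrier K" "x \<in> carrier M" "y \<in> carrier N"
  shows "pure_tensor K M N (c \<odot>\<^bsub>M\<^esub> x) y = c \<odot>\<^bsub>T\<^esub> pure_tensor K M N x y"
  using assms unfolding pure_tensor_def by (simp add: tensor_smult)

lemma pure_smult_right:
  assumes "c \<in> carrier K" "x \<in> carrier M" "y \<in> carrier N"
  shows "pure_tensor K M N x (c \<odot>\<^bsub>N\<^esub> y) = c \<odot>\<^bsub>T\<^esub> pure_tensor K M N x y"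
proof -
  have "frag_of (c \<odot>\<^bsub>M\<^esub> x, y) - frag_of (x, c \<odot>\<^bsub>N\<^esub> y) \<in> H"
    using assms by (intro relation_in_H) (unfold tensor_relations_def, blast)
  then have "pure_tensor K M N (c \<odot>\<^bsub>M\<^esub> x) y = pure_tensor K M N x (c \<odot>\<^bsub>N\<^esub> y)"
    using assms unfolding pure_tensor_def by (subst coset_eq_iff) auto
  then show ?thesis
    using assms by (simp add: pure_smult_left)
qed

lemma linear_maps_eqI:
  assumes P: "module K P" and f: "f \<in> linear_maps K T P" and g: "g \<in> linear_maps K T P"
    and eq: "\<And>x y. x \<in> carrier M \<Longrightarrow> y \<in> carrier N \<Longrightarrow>
      f (pure_tensor K M N x y) = g (pure_tensor K M N x y)"
    and t: "t \<in> carrier T"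
  shows "f t = g t"
proof -
  interpret P: module K P by (rule P)
  interpret T: module K T by (rule tensor_module)
  obtain u where u: "u \<in> carrier F" "t = H #>\<^bsub>F\<^esub> u" using t unfolding tensor_carrier by blast
  have add: "h (s \<oplus>\<^bsub>T\<^esub> s') = h s \<oplus>\<^bsub>P\<^esub> h s'" and cl: "h s \<in> carrier P"
    if "h \<in> linear_maps K T P" "s \<in> carrier T" "s' \<in> carrier T" for h s s'
    using that unfolding linear_maps_def by auto
  have keys: "Poly_Mapping.keys u \<subseteq> carrier M \<times> carrier N" using u by simp
  then have "f (H #>\<^bsub>F\<^esub> u) = g (H #>\<^bsub>F\<^esub> u)"
  proof (induction rule: free_Abelian_group_induct[consumes 1])
    case 1
    have "h (H #>\<^bsub>F\<^esub> 0) = \<zero>\<^bsub>P\<^esub>" if "h \<in> linear_maps K T P" for h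
      using add[OF that, of "\<zero>\<^bsub>T\<^esub>" "\<zero>\<^bsub>T\<^esub>"] cl[OF that T.zero_closed T.zero_closed]
      by (simp add: tensor_zero[symmetric])
    from this[OF f] this[OF g] show ?case by (simp only:)
  next
    case (2 u v)
    have uv: "u \<in> carrier F" "v \<in> carrier F" "u - v \<in> carrier F"
      using 2 diff_carrier[of u v] by auto
    have *: "h (H #>\<^bsub>F\<^esub> (u - v)) \<oplus>\<^bsub>P\<^esub> h (H #>\<^bsub>F\<^esub> v) = h (H #>\<^bsub>F\<^esub> u)" if "h \<in> linear_maps K T P" for h
      using add[OF that, of "H #>\<^bsub>F\<^esub> (u - v)" "H #>\<^bsub>F\<^esub> v"] uv
      by (simp add: tensor_add del: carrier_free_Abelian_group_iff)
    have "f (H #>\<^bsub>F\<^esub> (u - v)) \<oplus>\<^bsub>P\<^esub> f (H #>\<^bsub>F\<^esub> v) = g (H #>\<^bsub>F\<^esub> (u - v)) \<oplus>\<^bsub>P\<^esub> f (H #>\<^bsub>F\<^esub> v)"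
      using *[OF f] *[OF g] 2 by simp
    then show ?case
      using cl[OF f] cl[OF g] uv coset_closed by (metis P.M.add.right_cancel)
  next
    case (3 p)
    then show ?case using eq unfolding pure_tensor_def by (cases p) auto
  qed
  then show ?thesis using u by simp
qed

lemma
  assumes P: "module K P"
    and closed: "\<And>x y. x \<in> carrier M \<Longrightarrow> y \<in> carrier N \<Longrightarrow> B x y \<in> carrier P"
    and add_left: "\<And>x x' y. x \<in> carrier M \<Longrightarrow> x' \<in> carrier M \<Longrightarrow> y \<in> carrier N \<Longrightarrow>
      B (x \<oplus>\<^bsub>M\<^esub> x') y = B x y \<oplus>\<^bsub>P\<^esub> B x' y"
    and add_right: "\<And>x y y'. x \<in> carrier M \<Longrightarrow> y \<in> carrier N \<Longrightarrow> y' \<in> carrier N \<Longrightarrow>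
      B x (y \<oplus>\<^bsub>N\<^esub> y') = B x y \<oplus>\<^bsub>P\<^esub> B x y'"
    and smult_left: "\<And>c x y. c \<in> carrier K \<Longrightarrow> x \<in> carrier M \<Longrightarrow> y \<in> carrier N \<Longrightarrow>
      B (c \<odot>\<^bsub>M\<^esub> x) y = c \<odot>\<^bsub>P\<^esub> B x y"
    and smult_right: "\<And>c x y. c \<in> carrier K \<Longrightarrow> x \<in> carrier M \<Longrightarrow> y \<in> carrier N \<Longrightarrow>
      B x (c \<odot>\<^bsub>N\<^esub> y) = c \<odot>\<^bsub>P\<^esub> B x y"
  shows tensor_lift_linear: "tensor_lift K M N P B \<in> linear_maps K T P"
    and tensor_lift_pure: "\<And>x y. x \<in> carrier M \<Longrightarrow> y \<in> carrier N \<Longrightarrow>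
      tensor_lift K M N P B (pure_tensor K M N x y) = B x y"
proof -
  interpret P: module K P by (rule P)
  obtain h where h: "h \<in> hom F (add_monoid P)"
    and hB: "\<And>p. p \<in> carrier M \<times> carrier N \<Longrightarrow> h (frag_of p) = (\<lambda>(x, y). B x y) p"
    by (rule comm_group.free_Abelian_group_universal[OF P.M.a_comm_group, of "\<lambda>(x, y). B x y" "carrier M \<times> carrier N"])
      (use closed in auto)
  interpret h: group_hom F "add_monoid P" h
    by (simp add: group_hom_def group_hom_axioms_def h F.group_axioms P.M.a_group)
  have hF: "h u \<in> carrier P" if "u \<in> carrier F" for u
    using h.hom_closed[OF that] by simp
  have hadd: "h (u + v) = h u \<oplus>\<^bsub>P\<^esub> h v" if "u \<in> carrier F" "v \<in> carrier F" for u v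
    using h.hom_mult[OF that] by (simp del: carrier_free_Abelian_group_iff)
  have hdiff: "h (u - v) = h u \<ominus>\<^bsub>P\<^esub> h v" if uv: "u \<in> carrier F" "v \<in> carrier F" for u v
  proof -
    have "h (u - v) \<oplus>\<^bsub>P\<^esub> h v = h u"
      using hadd[OF diff_carrier[OF uv] uv(2)] by simp
    then show ?thesis
      using hF[OF diff_carrier[OF uv]] hF[OF uv(1)] hF[OF uv(2)]
      by (metis P.M.add.inv_solve_right' a_minus_def)
  qed
  have rel: "h u = \<zero>\<^bsub>P\<^esub>" if "u \<in> tensor_relations K M N" for u
  proof -
    note simps = hdiff hB diff_carrier frag_carrier add_left add_right smult_left smult_right closed
    from that consider
      (1) x x' y where "u = frag_of (x \<oplus>\<^bsub>M\<^esub> x', y) - frag_of (x, y) - frag_of (x', y)"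
        "x \<in> carrier M" "x' \<in> carrier M" "y \<in> carrier N"
    | (2) x y y' where "u = frag_of (x, y \<oplus>\<^bsub>N\<^esub> y') - frag_of (x, y) - frag_of (x, y')"
        "x \<in> carrier M" "y \<in> carrier N" "y' \<in> carrier N"
    | (3) d x y where "u = frag_of (d \<odot>\<^bsub>M\<^esub> x, y) - frag_of (x, d \<odot>\<^bsub>N\<^esub> y)"
        "d \<in> carrier K" "x \<in> carrier M" "y \<in> carrier N"
      unfolding tensor_relations_def by blast
    then show ?thesis
    proof cases
      case 1
      then show ?thesis
        by (simp add: simps del: carrier_free_Abelian_group_iff frag_of_in_free_Abelian_group)
          (simp add: closed P.M.minus_eq P.M.a_ac P.M.r_neg P.M.r_neg1)
    next
      case 2
      then show ?thesis
        by (simp add: simps del: carrier_free_Abelian_group_iff frag_of_in_free_Abelian_group)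
          (simp add: closed P.M.minus_eq P.M.a_ac P.M.r_neg P.M.r_neg1)
    next
      case 3
      then show ?thesis
        by (simp add: simps del: carrier_free_Abelian_group_iff frag_of_in_free_Abelian_group)
          (simp add: closed P.M.minus_eq P.M.r_neg)
    qed
  qed
  have "tensor_relations K M N \<subseteq> kernel F (add_monoid P) h"
    using rel relations_carrier by (auto simp: kernel_def simp del: carrier_free_Abelian_group_iff)
  then have "H \<subseteq> kernel F (add_monoid P) h"
    unfolding tensor_kernel_def by (rule F.generate_subgroup_incl[OF _ h.subgroup_kernel])
  then obtain g where g: "g \<in> hom (F Mod H) (add_monoid P)"
    and gh: "\<And>u. u \<in> carrier F \<Longrightarrow> g (H #>\<^bsub>F\<^esub> u) = h u"
    by (rule h.FactGroup_universal_kernel[OF H.normal_axioms]) blast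
  have hscl: "h (scl c u) = c \<odot>\<^bsub>P\<^esub> h u" if c: "c \<in> carrier K" and u: "u \<in> carrier F" for c u
  proof -
    have "Poly_Mapping.keys u \<subseteq> carrier M \<times> carrier N" using u by simp
    then show ?thesis
    proof (induction rule: free_Abelian_group_induct[consumes 1])
      case 1
      show ?case using h.hom_one c by simp
    next
      case (2 u v)
      then have uv: "u \<in> carrier F" "v \<in> carrier F" by simp_all
      then show ?case
        using 2 c by (simp add: frag_extend_diff hdiff scl_carrier hF P.M.minus_eq P.smult_r_distr
            P.smult_r_minus del: carrier_free_Abelian_group_iff)
    next
      case (3 p)
      then show ?case using c hB smult_left by (cases p) simp
    qed
  qed
  have "g \<in> linear_maps K T P"
    unfolding linear_maps_def tensor_carrier
    by (auto simp: tensor_add tensor_smult gh hadd hscl hF scl_carrier add_carrier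
        simp del: carrier_free_Abelian_group_iff)
  moreover have "\<forall>x\<in>carrier M. \<forall>y\<in>carrier N. g (pure_tensor K M N x y) = B x y"
    unfolding pure_tensor_def using hB by (simp add: gh)
  ultimately have "\<exists>f. f \<in> linear_maps K T P \<and>
      (\<forall>x\<in>carrier M. \<forall>y\<in>carrier N. f (pure_tensor K M N x y) = B x y)"
    by blast
  from someI_ex[OF this, folded tensor_lift_def]
  show "tensor_lift K M N P B \<in> linear_maps K T P"
    and "\<And>x y. x \<in> carrier M \<Longrightarrow> y \<in> carrier N \<Longrightarrow>
      tensor_lift K M N P B (pure_tensor K M N x y) = B x y"
    by blast+
qed

end


section \<open>Cobraided Hom-bialgebras\<close>

text \<open>The product of the Hom-bialgebra is the map \<open>\<mu>\<close> on \<open>A \<otimes> A\<close>, not the field \<open>mult\<close> of the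
  record \<open>A\<close>, which only provides the underlying module. All maps matter only on the carriers.

  If \<open>\<Delta> x = \<Sum> x\<^sub>1 \<otimes> x\<^sub>2\<close> and \<open>B\<close> is bilinear with values in \<open>P\<close>, then \<open>sweedler P B x\<close> is the
  Sweedler sum \<open>\<Sum> B x\<^sub>1 x\<^sub>2\<close>.\<close>

locale hom_structure = module K A
  for K :: "('k, 'm) ring_scheme" (structure) and A :: "('k, 'a, 'p) module_scheme" (structure) +
  fixes \<mu> :: "('a \<times> 'a \<Rightarrow>\<^sub>0 int) set \<Rightarrow> 'a"
    and \<Delta> :: "'a \<Rightarrow> ('a \<times> 'a \<Rightarrow>\<^sub>0 int) set"
    and \<alpha> :: "'a \<Rightarrow> 'a"
begin

abbreviation "AA \<equiv> tensor K A A"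

abbreviation pure (infix "\<boxtimes>" 65)
  where "x \<boxtimes> y \<equiv> pure_tensor K A A x y"

abbreviation prd (infixl "\<star>" 70)
  where "x \<star> y \<equiv> \<mu> (x \<boxtimes> y)"

abbreviation sweedler :: "('k, 'c, 'r) module_scheme \<Rightarrow> ('a \<Rightarrow> 'a \<Rightarrow> 'c) \<Rightarrow> 'a \<Rightarrow> 'c"
  where "sweedler P B x \<equiv> tensor_lift K A A P B (\<Delta> x)"

end

locale hom_bialgebra = hom_structure K A \<mu> \<Delta> \<alpha>
  for K :: "('k, 'm) ring_scheme" (structure) and A :: "('k, 'a, 'p) module_scheme" (structure)
    and \<mu> \<Delta> \<alpha> +
  assumes mu_linear: "\<mu> \<in> linear_maps K AA A"
    and Delta_linear: "\<Delta> \<in> linear_maps K A AA"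
    and alpha_linear: "\<alpha> \<in> linear_maps K A A"
    and alpha_mu: "t \<in> carrier AA \<Longrightarrow> \<alpha> (\<mu> t) = \<mu> (tensor_map K A A A A \<alpha> \<alpha> t)"
    and hom_assoc: "u \<in> carrier (tensor K AA A) \<Longrightarrow>
      \<mu> (tensor_map K A AA A A \<alpha> \<mu> (tensor_assoc K A A A u)) =
      \<mu> (tensor_map K AA A A A \<mu> \<alpha> u)"
    and alpha_Delta: "a \<in> carrier A \<Longrightarrow> tensor_map K A A A A \<alpha> \<alpha> (\<Delta> a) = \<Delta> (\<alpha> a)"
    and hom_coassoc: "a \<in> carrier A \<Longrightarrow>
      tensor_map K A A A AA \<alpha> \<Delta> (\<Delta> a) =
      tensor_assoc K A A A (tensor_map K A A AA A \<Delta> \<alpha> (\<Delta> a))"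
    and Delta_mu: "a \<in> carrier A \<Longrightarrow> b \<in> carrier A \<Longrightarrow>
      \<Delta> (a \<star> b) =
      sweedler AA (\<lambda>a1 a2. sweedler AA (\<lambda>b1 b2. (a1 \<star> b1) \<boxtimes> (a2 \<star> b2)) b) a"

locale cobraided_hom_bialgebra = hom_bialgebra K A \<mu> \<Delta> \<alpha>
  for K :: "('k, 'm) ring_scheme" (structure) and A :: "('k, 'a, 'p) module_scheme" (structure)
    and \<mu> \<Delta> \<alpha> +
  fixes r :: "('a \<times> 'a \<Rightarrow>\<^sub>0 int) set \<Rightarrow> 'k"
  assumes r_linear: "r \<in> linear_maps K AA (regular_module K)"
    and r_mult_left: "x \<in> carrier A \<Longrightarrow> y \<in> carrier A \<Longrightarrow> z \<in> carrier A \<Longrightarrow>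
      r ((x \<star> y) \<boxtimes> \<alpha> z) =
      sweedler (regular_module K) (\<lambda>z1 z2. r (\<alpha> x \<boxtimes> z1) \<otimes> r (\<alpha> y \<boxtimes> z2)) z"
    and r_mult_right: "x \<in> carrier A \<Longrightarrow> y \<in> carrier A \<Longrightarrow> z \<in> carrier A \<Longrightarrow>
      r (\<alpha> x \<boxtimes> (y \<star> z)) =
      sweedler (regular_module K) (\<lambda>x1 x2. r (x1 \<boxtimes> \<alpha> z) \<otimes> r (x2 \<boxtimes> \<alpha> y)) x"
    and r_commute: "x \<in> carrier A \<Longrightarrow> y \<in> carrier A \<Longrightarrow>
      sweedler A (\<lambda>x1 x2. sweedler A (\<lambda>y1 y2. r (x2 \<boxtimes> y2) \<odot>\<^bsub>A\<^esub> (y1 \<star> x1)) y) x =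
      sweedler A (\<lambda>x1 x2. sweedler A (\<lambda>y1 y2. r (x1 \<boxtimes> y1) \<odot>\<^bsub>A\<^esub> (x2 \<star> y2)) y) x"

end

theory Submission
  imports Defs
begin

text \<open>
  A cobraiding \<open>R\<close> can be pulled back to \<open>R \<circ> (\<beta> \<otimes> \<beta>)\<close> along any injective endomorphism \<open>\<beta>\<close> of the
  Hom-bialgebra, that is, along an injective linear map compatible with \<open>\<mu>\<close>, \<open>\<Delta>\<close> and \<open>\<alpha>\<close>
  (\<open>cobraided_pullback\<close>). The Hom-bialgebra axioms make every power of \<open>\<alpha>\<close> such an endomorphism
  (\<open>endomorphism_alpha_power\<close>).

  The tool is that \<open>\<beta>\<close> moves through Sweedler sums: as \<open>\<Delta> \<circ> \<beta> = (\<beta> \<otimes> \<beta>) \<circ> \<Delta>\<close>,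
  the sum of \<open>B (\<beta> x\<^sub>1) (\<beta> x\<^sub>2)\<close> over \<open>\<Delta> x\<close> is the sum of \<open>B\<close> over \<open>\<Delta> (\<beta> x)\<close> (\<open>sweedler_endo\<close>). So the first two
  axioms for \<open>R \<circ> (\<beta> \<otimes> \<beta>)\<close> at \<open>x, y, z\<close> are those for \<open>R\<close> at \<open>\<beta> x, \<beta> y, \<beta> z\<close>. The commutation
  axiom is an equation in \<open>A\<close> whose terms \<open>y\<^sub>1 x\<^sub>1\<close> carry no \<open>\<beta>\<close>; after \<open>\<beta>\<close> is applied to both
  sides it becomes the axiom for \<open>R\<close> at \<open>\<beta> x, \<beta> y\<close>, and injectivity of \<open>\<beta>\<close> cancels the \<open>\<beta>\<close> again.

  Each such manipulation requires the summand to be bilinear, since only then is the Sweedler sum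
  the value of a linear map on the tensor product.
\<close>

section \<open>Linear and bilinear maps\<close>

lemma linear_mapsD:
  assumes "f \<in> linear_maps K M N"
  shows "x \<in> carrier M \<Longrightarrow> f x \<in> carrier N"
    and "x \<in> carrier M \<Longrightarrow> y \<in> carrier M \<Longrightarrow> f (x \<oplus>\<^bsub>M\<^esub> y) = f x \<oplus>\<^bsub>N\<^esub> f y"
    and "c \<in> carrier K \<Longrightarrow> x \<in> carrier M \<Longrightarrow> f (c \<odot>\<^bsub>M\<^esub> x) = c \<odot>\<^bsub>N\<^esub> f x"
  using assms unfolding linear_maps_def by auto

lemma linear_mapsI:
  assumes "\<And>x. x \<in> carrier M \<Longrightarrow> f x \<in> carrier N"
    and "\<And>x y. x \<in> carrier M \<Longrightarrow> y \<in> carrier M \<Longrightarrow> f (x \<oplus>\<^bsub>M\<^esub> y) = f x \<oplus>\<^bsub>N\<^esub> f y"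
    and "\<And>c x. c \<in> carrier K \<Longrightarrow> x \<in> carrier M \<Longrightarrow> f (c \<odot>\<^bsub>M\<^esub> x) = c \<odot>\<^bsub>N\<^esub> f x"
  shows "f \<in> linear_maps K M N"
  using assms unfolding linear_maps_def by auto

lemma linear_maps_comp:
  assumes "f \<in> linear_maps K M N" "g \<in> linear_maps K N P"
  shows "(\<lambda>x. g (f x)) \<in> linear_maps K M P"
  by (intro linear_mapsI) (simp_all add: linear_mapsD[OF assms(1)] linear_mapsD[OF assms(2)])

lemma linear_maps_funpow:
  assumes "f \<in> linear_maps K M M"
  shows "f ^^ n \<in> linear_maps K M M"
proof (induction n)
  case 0
  show ?case by (rule linear_mapsI) simp_all
next
  case (Suc n)
  then show ?case using linear_maps_comp[OF Suc assms] by (simp add: comp_def)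
qed

definition bilinear_maps ::
  "('k, 'm) ring_scheme \<Rightarrow> ('k, 'a, 'p) module_scheme \<Rightarrow> ('k, 'b, 'q) module_scheme
     \<Rightarrow> ('k, 'c, 'r) module_scheme \<Rightarrow> ('a \<Rightarrow> 'b \<Rightarrow> 'c) set"
  where
  "bilinear_maps K M N P =
     {B. (\<forall>y\<in>carrier N. (\<lambda>x. B x y) \<in> linear_maps K M P) \<and>
         (\<forall>x\<in>carrier M. B x \<in> linear_maps K N P)}"

lemma bilinear_mapsI:
  assumes "\<And>y. y \<in> carrier N \<Longrightarrow> (\<lambda>x. B x y) \<in> linear_maps K M P"
    and "\<And>x. x \<in> carrier M \<Longrightarrow> B x \<in> linear_maps K N P"
  shows "B \<in> bilinear_maps K M N P"
  using assms unfolding bilinear_maps_def by auto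

lemma bilinear_mapsD:
  assumes "B \<in> bilinear_maps K M N P"
  shows "y \<in> carrier N \<Longrightarrow> (\<lambda>x. B x y) \<in> linear_maps K M P"
    and "x \<in> carrier M \<Longrightarrow> B x \<in> linear_maps K N P"
  using assms unfolding bilinear_maps_def by auto

lemma bilinear_maps_precomp:
  assumes "f \<in> linear_maps K M M'" "g \<in> linear_maps K N N'" "B \<in> bilinear_maps K M' N' P"
  shows "(\<lambda>x y. B (f x) (g y)) \<in> bilinear_maps K M N P"
  by (intro bilinear_mapsI linear_maps_comp[OF assms(1)] linear_maps_comp[OF assms(2)]
      bilinear_mapsD[OF assms(3)] linear_mapsD(1)[OF assms(1)] linear_mapsD(1)[OF assms(2)])

lemma bilinear_maps_postcomp:
  assumes "B \<in> bilinear_maps K M N P" "f \<in> linear_maps K P Q"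
  shows "(\<lambda>x y. f (B x y)) \<in> bilinear_maps K M N Q"
  by (intro bilinear_mapsI linear_maps_comp[OF _ assms(2)] bilinear_mapsD[OF assms(1)])

lemma regular_module_simps [simp]:
  "carrier (regular_module K) = carrier K"
  "x \<oplus>\<^bsub>regular_module K\<^esub> y = x \<oplus>\<^bsub>K\<^esub> y"
  "c \<odot>\<^bsub>regular_module K\<^esub> x = c \<otimes>\<^bsub>K\<^esub> x"
  "\<zero>\<^bsub>regular_module K\<^esub> = \<zero>\<^bsub>K\<^esub>"
  by (simp_all add: regular_module_def)

lemma module_regular_module:
  assumes "cring K"
  shows "module K (regular_module K)"
proof -
  interpret cring K by (rule assms)
  show ?thesis
  proof (rule moduleI[OF assms])
    show "abelian_group (regular_module K)"
      by (rule abelian_groupI) (auto simp: a_ac intro: bexI[of _ "\<ominus>\<^bsub>K\<^esub> _"] l_neg)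
  qed (simp_all add: l_distr r_distr m_assoc)
qed

text \<open>The summands of the axioms for a cobraiding are products of a scalar and a vector, with each
  variable in one factor only. Their bilinearity reduces to the next two facts; for a product of two
  scalars the module is the regular one.\<close>

lemma (in module) linear_maps_smult_left:
  assumes "f \<in> linear_maps R N (regular_module R)" "m \<in> carrier M"
  shows "(\<lambda>x. f x \<odot>\<^bsub>M\<^esub> m) \<in> linear_maps R N M"
  using linear_mapsD[OF assms(1)] assms(2)
  by (intro linear_mapsI) (simp_all add: smult_l_distr smult_assoc1)

lemma (in module) linear_maps_smult_right:
  assumes "f \<in> linear_maps R N M" "c \<in> carrier R"
  shows "(\<lambda>x. c \<odot>\<^bsub>M\<^esub> f x) \<in> linear_maps R N M"
  using linear_mapsD[OF assms(1)] assms(2)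
  by (intro linear_mapsI)
    (simp_all add: smult_r_distr smult_assoc1[symmetric] R.m_comm)


section \<open>Calculus of induced maps on tensor products\<close>

lemma tensor_lift_cong:
  assumes "\<And>x y. x \<in> carrier M \<Longrightarrow> y \<in> carrier N \<Longrightarrow> B x y = B' x y"
  shows "tensor_lift K M N P B = tensor_lift K M N P B'"
  unfolding tensor_lift_def using assms by (intro arg_cong[where f = Eps] ext) auto

context tensor_pair
begin

lemma pure_bilinear: "pure_tensor K M N \<in> bilinear_maps K M N T"
  by (intro bilinear_mapsI linear_mapsI)
    (simp_all add: pure_closed pure_add_left pure_add_right pure_smult_left pure_smult_right)

lemma
  assumes P: "module K P" and B: "B \<in> bilinear_maps K M N P"
  shows lift_linear: "tensor_lift K M N P B \<in> linear_maps K T P"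
    and lift_pure: "x \<in> carrier M \<Longrightarrow> y \<in> carrier N \<Longrightarrow>
      tensor_lift K M N P B (pure_tensor K M N x y) = B x y"
proof -
  note left = linear_mapsD[OF bilinear_mapsD(1)[OF B]]
    and right = linear_mapsD[OF bilinear_mapsD(2)[OF B]]
  show "tensor_lift K M N P B \<in> linear_maps K T P"
    by (rule tensor_lift_linear[OF P]) (simp_all add: left right)
  show "tensor_lift K M N P B (pure_tensor K M N x y) = B x y"
    if "x \<in> carrier M" "y \<in> carrier N"
    by (rule tensor_lift_pure[OF P]) (simp_all add: left right that)
qed

lemma lift_closed:
  assumes "module K P" "B \<in> bilinear_maps K M N P" "t \<in> carrier T"
  shows "tensor_lift K M N P B t \<in> carrier P"
  by (rule linear_mapsD(1)[OF lift_linear[OF assms(1,2)] assms(3)])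

lemma lift_eqI:
  assumes P: "module K P" and f: "f \<in> linear_maps K T P" and B: "B \<in> bilinear_maps K M N P"
    and eq: "\<And>x y. x \<in> carrier M \<Longrightarrow> y \<in> carrier N \<Longrightarrow> f (pure_tensor K M N x y) = B x y"
    and t: "t \<in> carrier T"
  shows "tensor_lift K M N P B t = f t"
  by (rule linear_maps_eqI[OF P lift_linear[OF P B] f _ t]) (simp add: lift_pure[OF P B] eq)

lemma linear_map_lift:
  assumes P: "module K P" and Q: "module K Q" and B: "B \<in> bilinear_maps K M N P"
    and f: "f \<in> linear_maps K P Q" and t: "t \<in> carrier T"
  shows "f (tensor_lift K M N P B t) = tensor_lift K M N Q (\<lambda>x y. f (B x y)) t"
  by (rule lift_eqI[symmetric, OF Q linear_maps_comp[OF lift_linear[OF P B] f]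
        bilinear_maps_postcomp[OF B f] _ t])
    (simp add: lift_pure[OF P B])

text \<open>An induced map depends linearly on the bilinear map that induces it. So summing a form in four
  variables over two of them leaves a bilinear map in the others, which makes iterated Sweedler sums
  meaningful.\<close>

lemma lift_bilinear:
  assumes P: "module K P"
    and out: "\<And>x y. x \<in> carrier M \<Longrightarrow> y \<in> carrier N \<Longrightarrow>
      (\<lambda>u v. C u v x y) \<in> bilinear_maps K U V P"
    and inn: "\<And>u v. u \<in> carrier U \<Longrightarrow> v \<in> carrier V \<Longrightarrow> C u v \<in> bilinear_maps K M N P"
    and t: "t \<in> carrier T" and U: "module K U" and V: "module K V"
  shows "(\<lambda>u v. tensor_lift K M N P (C u v) t) \<in> bilinear_maps K U V P"
proof -
  interpret P: module K P by (rule P)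
  interpret U: module K U by (rule U)
  interpret V: module K V by (rule V)
  have add: "tensor_lift K M N P B t = tensor_lift K M N P B1 t \<oplus>\<^bsub>P\<^esub> tensor_lift K M N P B2 t"
    if B: "B \<in> bilinear_maps K M N P" "B1 \<in> bilinear_maps K M N P" "B2 \<in> bilinear_maps K M N P"
      and eq: "\<And>x y. x \<in> carrier M \<Longrightarrow> y \<in> carrier N \<Longrightarrow> B x y = B1 x y \<oplus>\<^bsub>P\<^esub> B2 x y"
    for B B1 B2
  proof (rule lift_eqI[OF P _ B(1) _ t])
    show "(\<lambda>t. tensor_lift K M N P B1 t \<oplus>\<^bsub>P\<^esub> tensor_lift K M N P B2 t) \<in> linear_maps K T P"
      using linear_mapsD[OF lift_linear[OF P B(2)]] linear_mapsD[OF lift_linear[OF P B(3)]]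
      by (intro linear_mapsI) (simp_all add: P.M.a_ac P.smult_r_distr)
  qed (simp add: lift_pure[OF P] B eq)
  have smult: "tensor_lift K M N P B t = c \<odot>\<^bsub>P\<^esub> tensor_lift K M N P B1 t"
    if B: "B \<in> bilinear_maps K M N P" "B1 \<in> bilinear_maps K M N P" and c: "c \<in> carrier K"
      and eq: "\<And>x y. x \<in> carrier M \<Longrightarrow> y \<in> carrier N \<Longrightarrow> B x y = c \<odot>\<^bsub>P\<^esub> B1 x y"
    for B B1 c
    by (rule lift_eqI[OF P P.linear_maps_smult_right[OF lift_linear[OF P B(2)] c] B(1) _ t])
      (simp add: lift_pure[OF P] B eq)
  show ?thesis
  proof (intro bilinear_mapsI linear_mapsI lift_closed[OF P inn t])
    fix u u' v assume uv: "u \<in> carrier U" "u' \<in> carrier U" "v \<in> carrier V"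
    then show "tensor_lift K M N P (C (u \<oplus>\<^bsub>U\<^esub> u') v) t =
        tensor_lift K M N P (C u v) t \<oplus>\<^bsub>P\<^esub> tensor_lift K M N P (C u' v) t"
      by (intro add inn linear_mapsD(2)[OF bilinear_mapsD(1)[OF out]]) simp_all
  next
    fix c u v assume uv: "c \<in> carrier K" "u \<in> carrier U" "v \<in> carrier V"
    then show "tensor_lift K M N P (C (c \<odot>\<^bsub>U\<^esub> u) v) t = c \<odot>\<^bsub>P\<^esub> tensor_lift K M N P (C u v) t"
      by (intro smult inn linear_mapsD(3)[OF bilinear_mapsD(1)[OF out]]) simp_all
  next
    fix u v v' assume uv: "u \<in> carrier U" "v \<in> carrier V" "v' \<in> carrier V"
    then show "tensor_lift K M N P (C u (v \<oplus>\<^bsub>V\<^esub> v')) t =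
        tensor_lift K M N P (C u v) t \<oplus>\<^bsub>P\<^esub> tensor_lift K M N P (C u v') t"
      by (intro add inn linear_mapsD(2)[OF bilinear_mapsD(2)[OF out]]) simp_all
  next
    fix c u v assume uv: "c \<in> carrier K" "u \<in> carrier U" "v \<in> carrier V"
    then show "tensor_lift K M N P (C u (c \<odot>\<^bsub>V\<^esub> v)) t = c \<odot>\<^bsub>P\<^esub> tensor_lift K M N P (C u v) t"
      by (intro smult inn linear_mapsD(3)[OF bilinear_mapsD(2)[OF out]]) simp_all
  qed
qed

end

locale tensor_pair_map = tensor_pair K M N + target: tensor_pair K M' N'
  for K :: "('k, 'm) ring_scheme" (structure)
    and M :: "('k, 'a, 'p) module_scheme" and N :: "('k, 'b, 'q) module_scheme"
    and M' :: "('k, 'c, 'r) module_scheme" and N' :: "('k, 'd, 's) module_scheme" +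
  fixes f g
  assumes f: "f \<in> linear_maps K M M'" and g: "g \<in> linear_maps K N N'"
begin

lemma
  shows tensor_map_linear: "tensor_map K M N M' N' f g \<in> linear_maps K T target.T"
    and tensor_map_pure: "x \<in> carrier M \<Longrightarrow> y \<in> carrier N \<Longrightarrow>
      tensor_map K M N M' N' f g (pure_tensor K M N x y) = pure_tensor K M' N' (f x) (g y)"
  unfolding tensor_map_def
  using lift_linear[OF target.tensor_module bilinear_maps_precomp[OF f g target.pure_bilinear]]
    lift_pure[OF target.tensor_module bilinear_maps_precomp[OF f g target.pure_bilinear]]
  by simp_all

lemma lift_tensor_map:
  assumes P: "module K P" and B: "B \<in> bilinear_maps K M' N' P" and t: "t \<in> carrier T"
  shows "tensor_lift K M' N' P B (tensor_map K M N M' N' f g t) =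
    tensor_lift K M N P (\<lambda>x y. B (f x) (g y)) t"
  by (rule lift_eqI[symmetric, OF P linear_maps_comp[OF tensor_map_linear target.lift_linear[OF P B]]
        bilinear_maps_precomp[OF f g B] _ t])
    (simp add: tensor_map_pure target.lift_pure[OF P B] linear_mapsD(1)[OF f] linear_mapsD(1)[OF g])

end


section \<open>Pulling a cobraiding back along an endomorphism\<close>

locale hom_bialgebra_endomorphism = hom_bialgebra K A \<mu> \<Delta> \<alpha>
  for K :: "('k, 'm) ring_scheme" (structure) and A :: "('k, 'a, 'p) module_scheme" (structure)
    and \<mu> \<Delta> \<alpha> +
  fixes \<beta> :: "'a \<Rightarrow> 'a"
  assumes endo_linear: "\<beta> \<in> linear_maps K A A"
    and endo_mult: "x \<in> carrier A \<Longrightarrow> y \<in> carrier A \<Longrightarrow> \<beta> (x \<star> y) = \<beta> x \<star> \<beta> y"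
    and endo_Delta: "x \<in> carrier A \<Longrightarrow> \<Delta> (\<beta> x) = tensor_map K A A A A \<beta> \<beta> (\<Delta> x)"
    and endo_alpha: "x \<in> carrier A \<Longrightarrow> \<beta> (\<alpha> x) = \<alpha> (\<beta> x)"
begin

sublocale endo: tensor_pair_map K A A A A \<beta> \<beta>
  by (intro tensor_pair_map.intro tensor_pair.intro tensor_pair_map_axioms.intro
      module_axioms endo_linear)

lemma sweedler_endo:
  assumes "module K P" "B \<in> bilinear_maps K A A P" "x \<in> carrier A"
  shows "sweedler P B (\<beta> x) = sweedler P (\<lambda>x1 x2. B (\<beta> x1) (\<beta> x2)) x"
  using endo.lift_tensor_map[OF assms(1,2) linear_mapsD(1)[OF Delta_linear assms(3)]]
  by (simp add: endo_Delta assms(3))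

text \<open>The iterated form needed for the commutation axiom, where \<open>\<beta>\<close> is applied to a double Sweedler sum:
  it passes through both sums to the summand, which there turns into a form in the images
  under \<open>\<beta>\<close>, and these are absorbed into the arguments.\<close>

lemma endo_double_sweedler:
  assumes D1: "\<And>x1 x2. x1 \<in> carrier A \<Longrightarrow> x2 \<in> carrier A \<Longrightarrow> D x1 x2 \<in> bilinear_maps K A A A"
    and D2: "\<And>y1 y2. y1 \<in> carrier A \<Longrightarrow> y2 \<in> carrier A \<Longrightarrow>
      (\<lambda>x1 x2. D x1 x2 y1 y2) \<in> bilinear_maps K A A A"
    and C1: "\<And>x1 x2. x1 \<in> carrier A \<Longrightarrow> x2 \<in> carrier A \<Longrightarrow> C x1 x2 \<in> bilinear_maps K A A A"
    and C2: "\<And>y1 y2. y1 \<in> carrier A \<Longrightarrow> y2 \<in> carrier A \<Longrightarrow>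
      (\<lambda>x1 x2. C x1 x2 y1 y2) \<in> bilinear_maps K A A A"
    and eq: "\<And>x1 x2 y1 y2. x1 \<in> carrier A \<Longrightarrow> x2 \<in> carrier A \<Longrightarrow> y1 \<in> carrier A \<Longrightarrow> y2 \<in> carrier A \<Longrightarrow>
      \<beta> (D x1 x2 y1 y2) = C (\<beta> x1) (\<beta> x2) (\<beta> y1) (\<beta> y2)"
    and x: "x \<in> carrier A" and y: "y \<in> carrier A"
  shows "\<beta> (sweedler A (\<lambda>x1 x2. sweedler A (D x1 x2) y) x) =
    sweedler A (\<lambda>x1 x2. sweedler A (C x1 x2) (\<beta> y)) (\<beta> x)"
proof -
  note endo_closed = linear_mapsD(1)[OF endo_linear]
  note Delta_closed = linear_mapsD(1)[OF Delta_linear]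
  note mod = module_axioms
  have inner: "\<beta> (sweedler A (D x1 x2) y) = sweedler A (C (\<beta> x1) (\<beta> x2)) (\<beta> y)"
    if "x1 \<in> carrier A" "x2 \<in> carrier A" for x1 x2
  proof -
    have "\<beta> (sweedler A (D x1 x2) y) = sweedler A (\<lambda>y1 y2. \<beta> (D x1 x2 y1 y2)) y"
      by (rule endo.linear_map_lift[OF mod mod D1[OF that] endo_linear Delta_closed[OF y]])
    also have "\<dots> = sweedler A (\<lambda>y1 y2. C (\<beta> x1) (\<beta> x2) (\<beta> y1) (\<beta> y2)) y"
      by (rule fun_cong[OF tensor_lift_cong]) (rule eq[OF that])
    also have "\<dots> = sweedler A (C (\<beta> x1) (\<beta> x2)) (\<beta> y)"
      by (rule sweedler_endo[symmetric, OF mod C1 y]) (simp_all add: that endo_closed)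
    finally show ?thesis .
  qed
  have "\<beta> (sweedler A (\<lambda>x1 x2. sweedler A (D x1 x2) y) x) =
      sweedler A (\<lambda>x1 x2. \<beta> (sweedler A (D x1 x2) y)) x"
    by (rule endo.linear_map_lift[OF mod mod endo.lift_bilinear[OF mod D2 D1 Delta_closed[OF y] mod mod]
          endo_linear Delta_closed[OF x]])
  also have "\<dots> = sweedler A (\<lambda>x1 x2. sweedler A (C (\<beta> x1) (\<beta> x2)) (\<beta> y)) x"
    by (rule fun_cong[OF tensor_lift_cong]) (rule inner)
  also have "\<dots> = sweedler A (\<lambda>x1 x2. sweedler A (C x1 x2) (\<beta> y)) (\<beta> x)"
    by (rule sweedler_endo[symmetric, OF mod endo.lift_bilinear[OF mod C2 C1
          Delta_closed[OF endo_closed[OF y]] mod mod] x])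
  finally show ?thesis .
qed

end

lemma (in hom_bialgebra) product_bilinear: "(\<lambda>x y. x \<star> y) \<in> bilinear_maps K A A A"
proof -
  interpret tensor_pair K A A by (intro tensor_pair.intro module_axioms)
  show ?thesis by (rule bilinear_maps_postcomp[OF pure_bilinear mu_linear])
qed

text \<open>Powers are handled by composing with \<open>\<alpha>\<close> once more, which uses \<open>\<alpha> \<circ> \<mu> = \<mu> \<circ> (\<alpha> \<otimes> \<alpha>)\<close> on pure
  tensors and, for the coproduct, functoriality
  \<open>(\<alpha> \<otimes> \<alpha>) \<circ> (\<alpha>\<^sup>n \<otimes> \<alpha>\<^sup>n) = \<alpha>\<^bsup>n+1\<^esup> \<otimes> \<alpha>\<^bsup>n+1\<^esup>\<close> of the tensor product.\<close>

lemma (in hom_bialgebra) endomorphism_alpha_power: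
  "hom_bialgebra_endomorphism K A \<mu> \<Delta> \<alpha> (\<alpha> ^^ n)"
proof (induction n)
  case 0
  interpret tensor_pair K A A by (intro tensor_pair.intro module_axioms)
  have id: "(\<lambda>x. x) \<in> linear_maps K A A" "(\<lambda>t. t) \<in> linear_maps K AA AA"
    by (simp_all add: linear_mapsI)
  have "t \<in> carrier AA \<Longrightarrow> tensor_map K A A A A (\<lambda>x. x) (\<lambda>x. x) t = t" for t
    unfolding tensor_map_def
    by (rule lift_eqI[OF tensor_module id(2) pure_bilinear]) simp_all
  then show ?case
    using linear_mapsD(1)[OF Delta_linear] id(1)
    by unfold_locales (simp_all add: id_def)
next
  case (Suc n)
  interpret beta: hom_bialgebra_endomorphism K A \<mu> \<Delta> \<alpha> "\<alpha> ^^ n" by (rule Suc)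
  interpret one: tensor_pair_map K A A A A \<alpha> \<alpha>
    by (intro tensor_pair_map.intro tensor_pair.intro tensor_pair_map_axioms.intro
        module_axioms alpha_linear)
  interpret step: tensor_pair_map K A A A A "\<alpha> ^^ Suc n" "\<alpha> ^^ Suc n"
    by (intro tensor_pair_map.intro tensor_pair.intro tensor_pair_map_axioms.intro
        module_axioms linear_maps_funpow alpha_linear)
  note closed = linear_mapsD(1)[OF beta.endo_linear] linear_mapsD(1)[OF alpha_linear]
    linear_mapsD(1)[OF Delta_linear]
  have mult: "\<alpha> (x \<star> y) = \<alpha> x \<star> \<alpha> y" if "x \<in> carrier A" "y \<in> carrier A" for x y
    using that by (simp add: alpha_mu beta.endo.pure_closed one.tensor_map_pure)
  have comp: "tensor_map K A A A A \<alpha> \<alpha> (tensor_map K A A A A (\<alpha> ^^ n) (\<alpha> ^^ n) t) =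
      tensor_map K A A A A (\<alpha> ^^ Suc n) (\<alpha> ^^ Suc n) t" if "t \<in> carrier AA" for t
    by (rule beta.endo.linear_maps_eqI[OF beta.endo.tensor_module
          linear_maps_comp[OF beta.endo.tensor_map_linear one.tensor_map_linear]
          step.tensor_map_linear _ that])
      (simp add: beta.endo.tensor_map_pure one.tensor_map_pure step.tensor_map_pure closed
        del: funpow.simps, simp)
  show ?case
  proof unfold_locales
    show "\<alpha> ^^ Suc n \<in> linear_maps K A A" by (intro linear_maps_funpow alpha_linear)
  next
    fix x assume x: "x \<in> carrier A"
    have "\<Delta> ((\<alpha> ^^ Suc n) x) = tensor_map K A A A A \<alpha> \<alpha> (\<Delta> ((\<alpha> ^^ n) x))"
      using x by (simp add: alpha_Delta closed)
    then show "\<Delta> ((\<alpha> ^^ Suc n) x) = tensor_map K A A A A (\<alpha> ^^ Suc n) (\<alpha> ^^ Suc n) (\<Delta> x)"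
      using x by (simp only: beta.endo_Delta comp closed)
  qed (simp_all add: beta.endo_mult beta.endo_alpha mult closed)
qed

lemma (in cobraided_hom_bialgebra) form_bilinear:
  "(\<lambda>x y. r (x \<boxtimes> y)) \<in> bilinear_maps K A A (regular_module K)"
proof -
  interpret tensor_pair K A A by (intro tensor_pair.intro module_axioms)
  show ?thesis by (rule bilinear_maps_postcomp[OF pure_bilinear r_linear])
qed

text \<open>The first two axioms only substitute \<open>\<beta> x, \<beta> y, \<beta> z\<close> in those for \<open>r\<close>, since there every element of
  \<open>A\<close> is an argument of the form. In the third, elements also occur outside the form, so the
  substitution yields \<open>\<beta>\<close> of the desired equation; this is where injectivity enters.\<close>

theorem (in cobraided_hom_bialgebra) cobraided_pullback:
  assumes endo: "hom_bialgebra_endomorphism K A \<mu> \<Delta> \<alpha> \<beta>"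
    and inj: "inj_on \<beta> (carrier A)"
  shows "cobraided_hom_bialgebra K A \<mu> \<Delta> \<alpha> (r \<circ> tensor_map K A A A A \<beta> \<beta>)"
proof -
  interpret hom_bialgebra_endomorphism K A \<mu> \<Delta> \<alpha> \<beta> by (rule endo)
  define r' where "r' = r \<circ> tensor_map K A A A A \<beta> \<beta>"
  have KK: "module K (regular_module K)" by (rule module_regular_module) (rule R.is_cring)
  interpret KK: module K "regular_module K" by (rule KK)
  note closed = linear_mapsD(1)[OF endo_linear] linear_mapsD(1)[OF alpha_linear]
    linear_mapsD(1)[OF Delta_linear] endo.pure_closed linear_mapsD(1)[OF mu_linear]
    linear_mapsD(1)[OF r_linear, simplified]
  have r'_pure: "r' (x \<boxtimes> y) = r (\<beta> x \<boxtimes> \<beta> y)" if "x \<in> carrier A" "y \<in> carrier A" for x y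
    using that by (simp add: r'_def endo.tensor_map_pure)
  note form1 = bilinear_mapsD(1)[OF form_bilinear] and form2 = bilinear_mapsD(2)[OF form_bilinear]
  have "cobraided_hom_bialgebra K A \<mu> \<Delta> \<alpha> r'"
  proof unfold_locales
    show "r' \<in> linear_maps K AA (regular_module K)"
      unfolding r'_def comp_def by (rule linear_maps_comp[OF endo.tensor_map_linear r_linear])
  next
    fix x y z assume xyz: "x \<in> carrier A" "y \<in> carrier A" "z \<in> carrier A"
    have bil: "(\<lambda>z1 z2. r (\<alpha> (\<beta> x) \<boxtimes> z1) \<otimes> r (\<alpha> (\<beta> y) \<boxtimes> z2)) \<in> bilinear_maps K A A (regular_module K)"
      using xyz
      by (intro bilinear_mapsI KK.linear_maps_smult_left[simplified]
          KK.linear_maps_smult_right[simplified] form2) (simp_all add: closed)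
    have "r' ((x \<star> y) \<boxtimes> \<alpha> z) = r ((\<beta> x \<star> \<beta> y) \<boxtimes> \<alpha> (\<beta> z))"
      using xyz by (simp add: r'_pure closed endo_mult endo_alpha)
    also have "\<dots> = sweedler (regular_module K) (\<lambda>z1 z2. r (\<alpha> (\<beta> x) \<boxtimes> z1) \<otimes> r (\<alpha> (\<beta> y) \<boxtimes> z2)) (\<beta> z)"
      using xyz by (simp add: r_mult_left closed)
    also have "\<dots> = sweedler (regular_module K)
        (\<lambda>z1 z2. r (\<alpha> (\<beta> x) \<boxtimes> \<beta> z1) \<otimes> r (\<alpha> (\<beta> y) \<boxtimes> \<beta> z2)) z"
      by (rule sweedler_endo[OF KK bil xyz(3)])
    also have "\<dots> = sweedler (regular_module K) (\<lambda>z1 z2. r' (\<alpha> x \<boxtimes> z1) \<otimes> r' (\<alpha> y \<boxtimes> z2)) z"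
      using xyz by (intro arg_cong2[where f = "\<lambda>h t. h t", OF tensor_lift_cong refl])
        (simp add: r'_pure closed endo_alpha)
    finally show "r' ((x \<star> y) \<boxtimes> \<alpha> z) =
        sweedler (regular_module K) (\<lambda>z1 z2. r' (\<alpha> x \<boxtimes> z1) \<otimes> r' (\<alpha> y \<boxtimes> z2)) z" .
  next
    fix x y z assume xyz: "x \<in> carrier A" "y \<in> carrier A" "z \<in> carrier A"
    have bil: "(\<lambda>x1 x2. r (x1 \<boxtimes> \<alpha> (\<beta> z)) \<otimes> r (x2 \<boxtimes> \<alpha> (\<beta> y))) \<in> bilinear_maps K A A (regular_module K)"
      using xyz
      by (intro bilinear_mapsI KK.linear_maps_smult_left[simplified]
          KK.linear_maps_smult_right[simplified] form1) (simp_all add: closed)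
    have "r' (\<alpha> x \<boxtimes> (y \<star> z)) = r (\<alpha> (\<beta> x) \<boxtimes> (\<beta> y \<star> \<beta> z))"
      using xyz by (simp add: r'_pure closed endo_mult endo_alpha)
    also have "\<dots> = sweedler (regular_module K) (\<lambda>x1 x2. r (x1 \<boxtimes> \<alpha> (\<beta> z)) \<otimes> r (x2 \<boxtimes> \<alpha> (\<beta> y))) (\<beta> x)"
      using xyz by (simp add: r_mult_right closed)
    also have "\<dots> = sweedler (regular_module K)
        (\<lambda>x1 x2. r (\<beta> x1 \<boxtimes> \<alpha> (\<beta> z)) \<otimes> r (\<beta> x2 \<boxtimes> \<alpha> (\<beta> y))) x"
      by (rule sweedler_endo[OF KK bil xyz(1)])
    also have "\<dots> = sweedler (regular_module K) (\<lambda>x1 x2. r' (x1 \<boxtimes> \<alpha> z) \<otimes> r' (x2 \<boxtimes> \<alpha> y)) x"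
      using xyz by (intro arg_cong2[where f = "\<lambda>h t. h t", OF tensor_lift_cong refl])
        (simp add: r'_pure closed endo_alpha)
    finally show "r' (\<alpha> x \<boxtimes> (y \<star> z)) =
        sweedler (regular_module K) (\<lambda>x1 x2. r' (x1 \<boxtimes> \<alpha> z) \<otimes> r' (x2 \<boxtimes> \<alpha> y)) x" .
  next
    fix x y assume xy: "x \<in> carrier A" "y \<in> carrier A"
    have r'_bilinear: "(\<lambda>x y. r' (x \<boxtimes> y)) \<in> bilinear_maps K A A (regular_module K)"
      unfolding r'_def comp_def
      by (rule bilinear_maps_postcomp[OF endo.pure_bilinear
            linear_maps_comp[OF endo.tensor_map_linear r_linear]])
    have endo_term: "\<beta> (r' (a \<boxtimes> b) \<odot>\<^bsub>A\<^esub> (c \<star> d)) = r (\<beta> a \<boxtimes> \<beta> b) \<odot>\<^bsub>A\<^esub> (\<beta> c \<star> \<beta> d)"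
      if "a \<in> carrier A" "b \<in> carrier A" "c \<in> carrier A" "d \<in> carrier A" for a b c d
      using that by (simp add: r'_pure closed linear_mapsD(3)[OF endo_linear] endo_mult)
    let ?L' = "\<lambda>x1 x2 y1 y2. r' (x2 \<boxtimes> y2) \<odot>\<^bsub>A\<^esub> (y1 \<star> x1)"
    let ?R' = "\<lambda>x1 x2 y1 y2. r' (x1 \<boxtimes> y1) \<odot>\<^bsub>A\<^esub> (x2 \<star> y2)"
    let ?L = "\<lambda>x1 x2 y1 y2. r (x2 \<boxtimes> y2) \<odot>\<^bsub>A\<^esub> (y1 \<star> x1)"
    let ?R = "\<lambda>x1 x2 y1 y2. r (x1 \<boxtimes> y1) \<odot>\<^bsub>A\<^esub> (x2 \<star> y2)"
    have bil1: "(\<lambda>u v. \<phi> u \<odot>\<^bsub>A\<^esub> \<psi> v) \<in> bilinear_maps K A A A"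
      and bil2: "(\<lambda>u v. \<phi> v \<odot>\<^bsub>A\<^esub> \<psi> u) \<in> bilinear_maps K A A A"
      if "\<phi> \<in> linear_maps K A (regular_module K)" "\<psi> \<in> linear_maps K A A" for \<phi> \<psi>
      using that linear_mapsD(1)[OF that(1)] linear_mapsD(1)[OF that(2)]
      by (auto intro!: bilinear_mapsI linear_maps_smult_left linear_maps_smult_right)
    \<comment> \<open>Injectivity holds on the carrier only, so both sides must be seen to lie there.\<close>
    have closed_L: "sweedler A (\<lambda>x1 x2. sweedler A (?L' x1 x2) y) x \<in> carrier A"
      using xy by (intro endo.lift_closed[OF module_axioms] endo.lift_bilinear module_axioms
          closed bil2 bilinear_mapsD[OF r'_bilinear] bilinear_mapsD[OF product_bilinear])
    have closed_R: "sweedler A (\<lambda>x1 x2. sweedler A (?R' x1 x2) y) x \<in> carrier A"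
      using xy by (intro endo.lift_closed[OF module_axioms] endo.lift_bilinear module_axioms
          closed bil1 bilinear_mapsD[OF r'_bilinear] bilinear_mapsD[OF product_bilinear])
    have "\<beta> (sweedler A (\<lambda>x1 x2. sweedler A (?L' x1 x2) y) x) =
        sweedler A (\<lambda>x1 x2. sweedler A (?L x1 x2) (\<beta> y)) (\<beta> x)"
      using xy by (intro endo_double_sweedler bil2 endo_term bilinear_mapsD[OF r'_bilinear]
          bilinear_mapsD[OF form_bilinear] bilinear_mapsD[OF product_bilinear])
    also have "\<dots> = sweedler A (\<lambda>x1 x2. sweedler A (?R x1 x2) (\<beta> y)) (\<beta> x)"
      using xy by (intro r_commute closed)
    also have "\<dots> = \<beta> (sweedler A (\<lambda>x1 x2. sweedler A (?R' x1 x2) y) x)"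
      using xy by (intro endo_double_sweedler[symmetric] bil1 endo_term bilinear_mapsD[OF r'_bilinear]
          bilinear_mapsD[OF form_bilinear] bilinear_mapsD[OF product_bilinear])
    finally show "sweedler A (\<lambda>x1 x2. sweedler A (?L' x1 x2) y) x =
        sweedler A (\<lambda>x1 x2. sweedler A (?R' x1 x2) y) x"
      using inj closed_L closed_R by (simp add: inj_on_eq_iff)
  qed
  then show ?thesis by (simp only: r'_def)
qed

theorem theorem5p1:
  fixes K :: "('k, 'm) ring_scheme"
    and A :: "('k, 'a, 'p) module_scheme"
    and \<mu> :: "('a \<times> 'a \<Rightarrow>\<^sub>0 int) set \<Rightarrow> 'a"
    and \<Delta> :: "'a \<Rightarrow> ('a \<times> 'a \<Rightarrow>\<^sub>0 int) set"
    and \<alpha> :: "'a \<Rightarrow> 'a"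
    and r :: "('a \<times> 'a \<Rightarrow>\<^sub>0 int) set \<Rightarrow> 'k"
    and n :: nat
  assumes char_0: "\<And>m::nat. m > 0 \<Longrightarrow> [m] \<cdot>\<^bsub>K\<^esub> \<one>\<^bsub>K\<^esub> \<noteq> \<zero>\<^bsub>K\<^esub>"
    and cobraided: "cobraided_hom_bialgebra K A \<mu> \<Delta> \<alpha> r"
    and inj: "inj_on \<alpha> (carrier A)"
    and n: "n \<ge> 1"
  shows "cobraided_hom_bialgebra K A \<mu> \<Delta> \<alpha> (r \<circ> tensor_map K A A A A (\<alpha> ^^ n) (\<alpha> ^^ n))"
proof (rule cobraided_hom_bialgebra.cobraided_pullback[OF cobraided])
  interpret cobraided_hom_bialgebra K A \<mu> \<Delta> \<alpha> r by (rule cobraided)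
  show "hom_bialgebra_endomorphism K A \<mu> \<Delta> \<alpha> (\<alpha> ^^ n)" by (rule endomorphism_alpha_power)
  show "inj_on (\<alpha> ^^ n) (carrier A)"
  proof (induction n)
    case (Suc n)
    have "(\<alpha> ^^ n) ` carrier A \<subseteq> carrier A"
      using linear_mapsD(1)[OF linear_maps_funpow[OF alpha_linear]] by blast
    then show ?case
      using comp_inj_on[OF Suc inj_on_subset[OF inj]] by (simp add: comp_def)
  qed simp
qed

end
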